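(* For Online Slot Allocation: (i) For every integer $K\ge 1$, every online algorithm has competitive ratio at least $1+H_K$ (where $H_K=1+\frac12+\cdots+\frac1K$) on the class of all instances (with any number $n$ of items) whose cost vector lies in $\{0,1\}^n$ and has at most $K$ coefficients smaller than its maximum coefficient. (ii) Every online algorithm has competitive ratio at least $2$ on the class of all instances (with any $n$) whose cost vector is concave and lies in $\{0,1\}^n$.
   Context: Online Slot Allocation (OSA). An instance is a pair $(f,c)$: $n$ slots with costs $c_1\le\cdots\le c_n$ and $n$ items with hidden frequency vector $f\in\mathbb{R}_{+}^n$. Requests are drawn i.i.d. from $f/\sum_i f_i$; whenever a request is for an item $i$ not requested before, the algorithm must place $i$ in a vacant slot $j_i$; play stops once all items have been requested; the assignment cost is $\sum_i f_i c_{j_i}$. An algorithm is online if its (possibly randomized) choice of slot depends only on $c$, the requests so far, the current assignment and the new item, not on $f$. The cost of an algorithm is its expected assignment cost; $\mathrm{OPT}(f,c)$ is the minimum assignment cost over all bijections of items to slots; the competitive ratio on a class of instances is the supremum over the class of cost$/\mathrm{OPT}$. A cost vector is concave if $c_{i+2}-c_{i+1}\le c_{i+1}-c_i$ for all $i\in[n-2]$. *)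

theory Defs
  imports
    "HOL-Probability.Probability"
    "HOL-Analysis.Harmonic_Numbers"
    "HOL-Combinatorics.Permutations"
begin

text \<open>
  Items and slots are both numbered \<open>0, \<dots>, n - 1\<close>; the frequency vector and the cost vector are
  lists of length \<open>n\<close>. Frequencies are strictly positive, since an item of frequency \<open>0\<close> is
  almost surely never requested and play would not stop.
\<close>

definition osa_instance :: "real list \<Rightarrow> real list \<Rightarrow> bool" where
  "osa_instance f c \<longleftrightarrow>
     c \<noteq> [] \<and> length f = length c \<and> sorted c \<and> (\<forall>x\<in>set f. 0 < x)"

definition concave_costs :: "real list \<Rightarrow> bool" where
  "concave_costs c \<longleftrightarrow>
     (\<forall>i. i + 2 < length c \<longrightarrow> c ! (i + 2) - c ! (i + 1) \<le> c ! (i + 1) - c ! i)"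

definition num_below_max :: "real list \<Rightarrow> nat" where
  "num_below_max c = card {j. j < length c \<and> c ! j < Max (set c)}"

definition assignment_cost :: "real list \<Rightarrow> real list \<Rightarrow> (nat \<Rightarrow> nat) \<Rightarrow> real" where
  "assignment_cost f c \<pi> = (\<Sum>i<length f. f ! i * c ! \<pi> i)"

definition opt_cost :: "real list \<Rightarrow> real list \<Rightarrow> real" where
  "opt_cost f c = Min (assignment_cost f c ` {\<pi>. \<pi> permutes {..<length c}})"

text \<open>
  In \<open>A c rs \<sigma> i\<close>, \<open>c\<close> is the cost vector, \<open>rs\<close> the list of earlier requests (oldest first),
  \<open>\<sigma>\<close> the current partial assignment of items to slots, and \<open>i\<close> the newly requested item; the
  result is the distribution of the slot given to \<open>i\<close>. The frequencies are not an argument.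
\<close>

type_synonym slot_algorithm =
  "real list \<Rightarrow> nat list \<Rightarrow> (nat \<rightharpoonup> nat) \<Rightarrow> nat \<Rightarrow> nat pmf"

definition online_algorithm :: "slot_algorithm \<Rightarrow> bool" where
  "online_algorithm A \<longleftrightarrow>
     (\<forall>c rs \<sigma> i.
        sorted c \<and> set rs \<subseteq> {..<length c} \<and> i < length c \<and> i \<notin> set rs \<and>
        dom \<sigma> = set rs \<and> inj_on \<sigma> (dom \<sigma>) \<and> ran \<sigma> \<subseteq> {..<length c} \<longrightarrow>
        set_pmf (A c rs \<sigma> i) \<subseteq> {..<length c} - ran \<sigma>)"

fun play ::
  "slot_algorithm \<Rightarrow> real list \<Rightarrow> nat list \<Rightarrow> (nat \<rightharpoonup> nat) \<Rightarrow> nat list \<Rightarrow> (nat \<rightharpoonup> nat) pmf" where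
  "play A c rs \<sigma> [] = return_pmf \<sigma>"
| "play A c rs \<sigma> (i # is) =
     (if i \<in> dom \<sigma> then play A c (rs @ [i]) \<sigma> is
      else bind_pmf (A c rs \<sigma> i) (\<lambda>j. play A c (rs @ [i]) (\<sigma>(i \<mapsto> j)) is))"

definition request_pmf :: "real list \<Rightarrow> nat pmf" where
  "request_pmf f = embed_pmf (\<lambda>i. if i < length f then f ! i / sum_list f else 0)"

lemma pmf_request_pmf:
  assumes "f \<noteq> []" "\<forall>x\<in>set f. 0 < x"
  shows "pmf (request_pmf f) i = (if i < length f then f ! i / sum_list f else 0)"
proof -
  let ?p = "\<lambda>i. if i < length f then f ! i / sum_list f else 0"
  have s: "sum_list f = (\<Sum>i<length f. f ! i)"
    by (simp add: sum_list_sum_nth atLeast0LessThan)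
  have pos: "0 < sum_list f"
    unfolding s using assms by (intro sum_pos) (auto simp: lessThan_empty_iff)
  have nonneg: "0 \<le> ?p j" for j
    using assms pos by (auto intro!: divide_nonneg_nonneg simp: less_imp_le)
  have "(\<integral>\<^sup>+j. ennreal (?p j) \<partial>count_space UNIV) = (\<Sum>j<length f. ennreal (?p j))"
    by (subst nn_integral_count_space'[where A = "{..<length f}"]) auto
  also have "\<dots> = ennreal (\<Sum>j<length f. ?p j)"
    using nonneg by (intro sum_ennreal)
  also have "(\<Sum>j<length f. ?p j) = 1"
    using pos by (simp add: s flip: sum_divide_distrib)
  finally show ?thesis
    unfolding request_pmf_def using nonneg by (subst pmf_embed_pmf) auto
qed

text \<open>
  The first time at which all \<open>n\<close> items have been requested; it exists for almost every request
  stream, and its value on the remaining null set is irrelevant.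
\<close>

definition stop_time :: "nat \<Rightarrow> nat stream \<Rightarrow> nat" where
  "stop_time n w = (LEAST t. {..<n} \<subseteq> set (stake t w))"

definition final_assignment ::
  "slot_algorithm \<Rightarrow> real list \<Rightarrow> nat stream \<Rightarrow> (nat \<rightharpoonup> nat) pmf" where
  "final_assignment A c w = play A c [] Map.empty (stake (stop_time (length c) w) w)"

text \<open>
  For almost every stream the integrand depends only on a finite prefix, and it takes values between
  the least and greatest cost times the total frequency, so the integral is an honest expectation.
\<close>

definition algorithm_cost :: "slot_algorithm \<Rightarrow> real list \<Rightarrow> real list \<Rightarrow> real" where
  "algorithm_cost A f c =
     (\<integral>w. measure_pmf.expectation (final_assignment A c w)
              (\<lambda>\<sigma>. assignment_cost f c (the \<circ> \<sigma>))
       \<partial>stream_space (measure_pmf (request_pmf f)))"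

text \<open>
  For costs in \<open>{0, 1}\<close>, \<open>opt_cost\<close> vanishes only if all costs are \<open>0\<close>; then the cost of every
  algorithm is \<open>0\<close> too, and such instances contribute \<open>0 / 0 = 0\<close> to the supremum.
\<close>

definition competitive_ratio :: "slot_algorithm \<Rightarrow> (real list \<times> real list) set \<Rightarrow> ereal" where
  "competitive_ratio A \<I> = (SUP (f, c)\<in>\<I>. ereal (algorithm_cost A f c / opt_cost f c))"

end

theory Submission
  imports Defs
begin

text \<open>
  Take \<open>K\<close> free slots, one slot of cost \<open>1\<close>, \<open>K\<close> items of frequency \<open>1\<close> and one light item of
  frequency \<open>\<epsilon>\<close>, whose identity is uniformly random; the optimum is \<open>\<epsilon>\<close>. Play stops at the first
  request of the last new item, so a request sequence up to that time contains this item exactly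
  once. Its likelihood when \<open>l\<close> is the light item is proportional to \<open>\<epsilon>\<close> to the number of
  occurrences of \<open>l\<close>, hence the last item is always a most likely candidate for the light one, and
  no algorithm puts the light item into the expensive slot with probability greater than the
  probability \<open>p\<close> that the light item appears last. First-step analysis gives
  \<open>p = (\<Prod>r=1..K. r / (r + \<epsilon>)) \<le> 1 / (1 + \<epsilon> H\<^sub>K)\<close>. So for some choice of the light item the ratio is
  at least \<open>(1 - (1 - \<epsilon>) p) / \<epsilon> \<ge> (1 + H\<^sub>K) / (1 + \<epsilon> H\<^sub>K)\<close>, which tends to \<open>1 + H\<^sub>K\<close> as \<open>\<epsilon>\<close> tends
  to \<open>0\<close>. For \<open>K = 1\<close> the cost vector has two entries and is trivially concave.
\<close>

section \<open>First-step analysis of i.i.d. streams\<close>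

lemma space_iid_stream [simp]: "space (stream_space (measure_pmf q)) = UNIV"
  by (simp add: space_stream_space)

lemma prob_space_iid_stream: "prob_space (stream_space (measure_pmf q))"
  by (rule prob_space.prob_space_stream_space) (rule prob_space_measure_pmf)

lemma measurable_stake_pmf [measurable]:
  "stake t \<in> stream_space (measure_pmf q) \<rightarrow>\<^sub>M count_space (UNIV :: 'a::countable list set)"
proof -
  have "sets (stream_space (measure_pmf q)) = sets (stream_space (count_space (UNIV :: 'a set)))"
    by (intro sets_stream_space_cong) simp
  then show ?thesis
    using measurable_stake measurable_cong_sets by blast
qed

lemma pred_stake_pmf [measurable]:
  fixes q :: "'a::countable pmf"
  shows "Measurable.pred (stream_space (measure_pmf q)) (\<lambda>w. P (stake t w))"
  by (rule measurable_compose[OF measurable_stake_pmf]) simp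

text \<open>The first letter is independent of the rest of the stream, and finite support turns the
  integral over it into a sum. This conditioning is the source of all stream probabilities
  below.\<close>

lemma prob_stream_first_step:
  assumes "finite (set_pmf q)" "X \<in> sets (stream_space (measure_pmf q))"
  shows "measure (stream_space (measure_pmf q)) X =
    (\<Sum>i\<in>set_pmf q. pmf q i * measure (stream_space (measure_pmf q)) {w. i ## w \<in> X})"
proof -
  let ?M = "stream_space (measure_pmf q)"
  interpret S: prob_space ?M by (rule prob_space_iid_stream)
  have "emeasure ?M X = (\<integral>\<^sup>+i. emeasure ?M {w\<in>space ?M. i ## w \<in> X} \<partial>measure_pmf q)"
    using assms by (intro prob_space.emeasure_stream_space prob_space_measure_pmf)
  also have "\<dots> = (\<Sum>i\<in>set_pmf q. emeasure ?M {w. i ## w \<in> X} * pmf q i)"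
    using assms by (subst nn_integral_measure_pmf_finite) auto
  also have "\<dots> = (\<Sum>i\<in>set_pmf q. ennreal (pmf q i * measure ?M {w. i ## w \<in> X}))"
    by (intro sum.cong) (auto simp: S.emeasure_eq_measure ennreal_mult mult.commute)
  also have "\<dots> = ennreal (\<Sum>i\<in>set_pmf q. pmf q i * measure ?M {w. i ## w \<in> X})"
    by (intro sum_ennreal) auto
  finally show ?thesis
    by (simp add: S.emeasure_eq_measure sum_nonneg)
qed

text \<open>Only the summand \<open>i = x\<close> of the first step survives; if \<open>x\<close>
  lies outside the support, both sides vanish.\<close>

lemma prob_stake_eq:
  fixes q :: "'a::countable pmf"
  assumes "finite (set_pmf q)"
  shows "measure (stream_space (measure_pmf q)) {w. stake (length s) w = s} =
    prod_list (map (pmf q) s)"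
proof (induction s)
  case Nil
  show ?case
    using prob_space.prob_space[OF prob_space_iid_stream[of q]] by simp
next
  case (Cons x s)
  let ?M = "stream_space (measure_pmf q)"
  have "{w. stake (length (x # s)) w = x # s} = {w \<in> space ?M. stake (length (x # s)) w = x # s}"
    by simp
  also have "\<dots> \<in> sets ?M"
    by measurable
  finally have "measure ?M {w. stake (length (x # s)) w = x # s} =
      (\<Sum>i\<in>set_pmf q. pmf q i * measure ?M {w. i = x \<and> stake (length s) w = s})"
    by (subst prob_stream_first_step[OF assms]) auto
  also have "\<dots> = (\<Sum>i\<in>set_pmf q. if i = x then pmf q x * prod_list (map (pmf q) s) else 0)"
    by (intro sum.cong) (auto simp: Cons.IH)
  also have "\<dots> = pmf q x * prod_list (map (pmf q) s)"
    using assms by (auto simp: sum.delta' pmf_eq_0_set_pmf)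
  finally show ?case by simp
qed

text \<open>By the first step, the probability \<open>P\<close> that a given \<open>i\<close> is
  never requested satisfies \<open>P = (1 - pmf q i) * P\<close>, so it is \<open>0\<close> for
  \<open>i\<close> in the support. Finiteness of the support merges the exceptional sets.\<close>

lemma AE_all_requested:
  fixes q :: "'a::countable pmf"
  assumes "finite (set_pmf q)"
  shows "AE w in stream_space (measure_pmf q). \<exists>t. set_pmf q \<subseteq> set (stake t w)"
proof -
  let ?M = "stream_space (measure_pmf q)"
  interpret S: prob_space ?M by (rule prob_space_iid_stream)
  have single: "AE w in ?M. \<exists>t. i \<in> set (stake t w)" if i: "i \<in> set_pmf q" for i
  proof -
    let ?N = "{w. \<forall>t. i \<notin> set (stake t w)}"
    have "?N = {w \<in> space ?M. \<forall>t. i \<notin> set (stake t w)}" by simp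
    also have "\<dots> \<in> sets ?M" by measurable
    finally have N: "?N \<in> sets ?M" .
    have step: "k ## w \<in> ?N \<longleftrightarrow> k \<noteq> i \<and> w \<in> ?N" for k w
    proof
      assume k: "k ## w \<in> ?N"
      then have "i \<notin> set (stake (Suc t) (k ## w))" for t by blast
      then show "k \<noteq> i \<and> w \<in> ?N" by auto
    next
      assume k: "k \<noteq> i \<and> w \<in> ?N"
      have "i \<notin> set (stake t (k ## w))" for t
        using k by (cases t) auto
      then show "k ## w \<in> ?N" by blast
    qed
    have "measure ?M ?N = (\<Sum>k\<in>set_pmf q. pmf q k * measure ?M {w. k \<noteq> i \<and> w \<in> ?N})"
      by (subst prob_stream_first_step[OF assms N]) (simp only: step)
    also have "\<dots> = (\<Sum>k\<in>set_pmf q. pmf q k * measure ?M ?N - (if k = i then pmf q i * measure ?M ?N else 0))"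
      by (intro sum.cong) auto
    also have "\<dots> = (\<Sum>k\<in>set_pmf q. pmf q k) * measure ?M ?N - pmf q i * measure ?M ?N"
      using assms i by (simp add: sum_subtractf sum_distrib_right)
    also have "(\<Sum>k\<in>set_pmf q. pmf q k) = 1"
      using assms by (intro sum_pmf_eq_1) auto
    finally have "pmf q i * measure ?M ?N = 0" by simp
    then have "measure ?M ?N = 0"
      using i by (simp add: set_pmf_iff)
    then have "emeasure ?M ?N = 0"
      by (simp add: S.emeasure_eq_measure)
    with N show ?thesis
      by (intro AE_I[where N = ?N]) auto
  qed
  then have "AE w in ?M. \<forall>i\<in>set_pmf q. \<exists>t. i \<in> set (stake t w)"
    using assms by (intro AE_finite_allI) auto
  then show ?thesis
  proof eventually_elim
    case (elim w)
    then obtain t where t: "\<And>i. i \<in> set_pmf q \<Longrightarrow> i \<in> set (stake (t i) w)"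
      by metis
    \<comment> \<open>Prefixes grow with time, so the largest of the finitely many times
      \<open>t i\<close> serves all items at once.\<close>
    have "i \<in> set (stake (Max (t ` set_pmf q)) w)" if "i \<in> set_pmf q" for i
    proof -
      have "t i \<le> Max (t ` set_pmf q)" using assms that by auto
      then have "stake (t i) w = take (t i) (stake (Max (t ` set_pmf q)) w)"
        by (simp add: take_stake min_absorb1)
      with t[OF that] show ?thesis by (metis in_set_takeD)
    qed
    then show ?case by blast
  qed
qed

section \<open>The event that one item comes after all items of a given set\<close>

definition all_before :: "'a set \<Rightarrow> 'a \<Rightarrow> 'a stream set" where
  "all_before R l = {w. \<exists>t. R \<subseteq> set (stake t w) \<and> l \<notin> set (stake t w)}"

lemma all_before_empty [simp]: "all_before {} l = UNIV"
  by (auto simp: all_before_def intro: exI[of _ 0])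

text \<open>A nonempty \<open>R\<close> forces a nonempty witnessing prefix, which then contains the
  first letter. For \<open>R = {}\<close> the event is everything and the equivalence fails at
  \<open>i = l\<close>.\<close>

lemma SCons_all_before_iff:
  assumes "R \<noteq> {}"
  shows "i ## w \<in> all_before R l \<longleftrightarrow> i \<noteq> l \<and> w \<in> all_before (R - {i}) l"
proof
  assume "i ## w \<in> all_before R l"
  then obtain t where t: "R \<subseteq> set (stake t (i ## w))" "l \<notin> set (stake t (i ## w))"
    by (auto simp: all_before_def)
  with assms obtain u where "t = Suc u" by (cases t) auto
  with t show "i \<noteq> l \<and> w \<in> all_before (R - {i}) l"
    by (auto simp: all_before_def intro!: exI[of _ u])
next
  assume "i \<noteq> l \<and> w \<in> all_before (R - {i}) l"
  then obtain u where "i \<noteq> l" "R - {i} \<subseteq> set (stake u w)" "l \<notin> set (stake u w)"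
    by (auto simp: all_before_def)
  then show "i ## w \<in> all_before R l"
    unfolding all_before_def by (intro CollectI exI[of _ "Suc u"]) auto
qed

lemma all_before_sets:
  fixes q :: "'a::countable pmf"
  shows "all_before R l \<in> sets (stream_space (measure_pmf q))"
proof -
  let ?M = "stream_space (measure_pmf q)"
  have "all_before R l = {w \<in> space ?M. \<exists>t. R \<subseteq> set (stake t w) \<and> l \<notin> set (stake t w)}"
    by (simp add: all_before_def)
  also have "\<dots> \<in> sets ?M"
    using pred_stake_pmf[of "\<lambda>s. R \<subseteq> set s \<and> l \<notin> set s" _ q] by measurable
  finally show ?thesis .
qed

text \<open>A request of \<open>l\<close> decides against the event, a request of
  \<open>i \<in> R\<close> leaves \<open>R - {i}\<close>, and any other request changes nothing.
  Hence \<open>(card R + \<epsilon>) * ?P R = (\<Sum>i\<in>R. ?P (R - {i}))\<close>, and induction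
  on \<open>card R\<close> gives the bound. The support may be larger than \<open>R\<close> and
  \<open>l\<close>, because items removed from \<open>R\<close> can still be requested.\<close>

lemma prob_all_before:
  fixes q :: "'a::countable pmf"
  assumes fin: "finite (set_pmf q)" and "finite R" and "R \<subseteq> set_pmf q" and l: "l \<in> set_pmf q" "l \<notin> R"
    and heavy: "\<And>i. i \<in> R \<Longrightarrow> pmf q i = h" and light: "pmf q l = \<epsilon> * h"
    and h: "h > 0" and \<epsilon>: "\<epsilon> > 0"
  shows "measure (stream_space (measure_pmf q)) (all_before R l) * (1 + \<epsilon> * harm (card R)) \<le> 1"
  using \<open>finite R\<close> \<open>R \<subseteq> set_pmf q\<close> l(2) heavy
proof (induction "card R" arbitrary: R)
  case 0
  then show ?case
    using prob_space.prob_space[OF prob_space_iid_stream[of q]] by (simp add: harm_def)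
next
  case (Suc k)
  let ?M = "stream_space (measure_pmf q)"
  let ?P = "\<lambda>R. measure ?M (all_before R l)"
  have ne: "R \<noteq> {}" using Suc.hyps(2) by auto
  have IH: "?P (R - {i}) * (1 + \<epsilon> * harm k) \<le> 1" if "i \<in> R" for i
  proof -
    have "k = card (R - {i})" using Suc.hyps(2) Suc.prems(1) that by simp
    then show ?thesis using Suc.hyps(1)[of "R - {i}"] Suc.prems by auto
  qed
  \<comment> \<open>Each summand is written as the value for a request that changes nothing,
    corrected at \<open>l\<close> and on \<open>R\<close>. The uncorrected terms add up to
    \<open>?P R\<close> and cancel against the left side.\<close>
  have eq: "pmf q i * measure ?M {w. i \<noteq> l \<and> w \<in> all_before (R - {i}) l} =
     pmf q i * ?P R - (if i = l then \<epsilon> * h * ?P R else 0) + (if i \<in> R then h * (?P (R - {i}) - ?P R) else 0)"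
    for i
  proof (cases "i \<in> R")
    case True
    then show ?thesis using Suc.prems by (auto simp: algebra_simps)
  next
    case False
    then show ?thesis using light by auto
  qed
  have "?P R = (\<Sum>i\<in>set_pmf q. pmf q i * measure ?M {w. i \<noteq> l \<and> w \<in> all_before (R - {i}) l})"
    by (subst prob_stream_first_step[OF fin all_before_sets]) (simp only: SCons_all_before_iff[OF ne])
  also have "\<dots> = (\<Sum>i\<in>set_pmf q. pmf q i) * ?P R - \<epsilon> * h * ?P R + (\<Sum>i\<in>R. h * (?P (R - {i}) - ?P R))"
    unfolding eq using fin l Suc.prems(2)
    by (simp add: sum.distrib sum_subtractf sum_distrib_right sum.If_cases Int_absorb1)
  also have "(\<Sum>i\<in>set_pmf q. pmf q i) = 1"
    using fin by (intro sum_pmf_eq_1) auto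
  finally have "h * (\<epsilon> * ?P R) = h * (\<Sum>i\<in>R. ?P (R - {i}) - ?P R)"
    by (simp add: sum_distrib_left)
  with h have "\<epsilon> * ?P R = (\<Sum>i\<in>R. ?P (R - {i})) - card R * ?P R"
    by (simp add: sum_subtractf)
  then have rec: "(Suc k + \<epsilon>) * ?P R = (\<Sum>i\<in>R. ?P (R - {i}))"
    using Suc.hyps(2) by (simp add: algebra_simps)
  have "(Suc k + \<epsilon>) * ?P R * (1 + \<epsilon> * harm k) = (\<Sum>i\<in>R. ?P (R - {i}) * (1 + \<epsilon> * harm k))"
    by (simp only: rec sum_distrib_right)
  also have "\<dots> \<le> (\<Sum>i\<in>R. 1)" by (intro sum_mono IH)
  also have "\<dots> = real (Suc k)" using Suc.hyps(2) by simp
  finally have le: "(Suc k + \<epsilon>) * ?P R * (1 + \<epsilon> * harm k) \<le> Suc k" .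
  have "0 \<le> (harm k :: real)" by (simp add: harm_nonneg)
  \<comment> \<open>The two ends of this chain differ by
    \<open>\<epsilon> * \<epsilon> * harm k\<close>, so the passage from \<open>harm k\<close> to
    \<open>harm (Suc k)\<close> is only of second order in \<open>\<epsilon>\<close>.\<close>
  have "Suc k * (1 + \<epsilon> * harm (Suc k)) = Suc k * (1 + \<epsilon> * harm k) + \<epsilon>"
    by (simp add: harm_Suc field_simps)
  also have "\<dots> \<le> (Suc k + \<epsilon>) * (1 + \<epsilon> * harm k)"
    using \<epsilon> \<open>0 \<le> (harm k :: real)\<close> by (simp add: algebra_simps)
  finally have "?P R * (Suc k * (1 + \<epsilon> * harm (Suc k))) \<le> ?P R * ((Suc k + \<epsilon>) * (1 + \<epsilon> * harm k))"
    by (intro mult_left_mono) auto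
  also have "\<dots> \<le> Suc k" using le by (simp add: mult_ac)
  finally have "Suc k * (?P R * (1 + \<epsilon> * harm (Suc k))) \<le> Suc k * 1"
    by (simp add: mult_ac)
  then show ?case
    using Suc.hyps(2) by (simp del: of_nat_Suc)
qed

text \<open>The push-forward under a countable-valued \<open>T\<close> has its point masses as
  density. Integrals over different stream measures thus become sums over one common index set of
  request lists and can be compared term by term.\<close>

lemma nn_integral_discrete:
  fixes T :: "'a \<Rightarrow> 'b::countable"
  assumes T: "T \<in> M \<rightarrow>\<^sub>M count_space UNIV"
  shows "(\<integral>\<^sup>+w. g (T w) \<partial>M) = (\<integral>\<^sup>+s. emeasure M {w \<in> space M. T w = s} * g s \<partial>count_space UNIV)"
proof -
  let ?D = "density (count_space UNIV) (\<lambda>s. emeasure M {w \<in> space M. T w = s})"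
  have "distr M (count_space UNIV) T = ?D"
  proof (rule measure_eqI_countable[where A = UNIV])
    fix s
    have "T -` {s} \<inter> space M = {w \<in> space M. T w = s}" by auto
    then show "emeasure (distr M (count_space UNIV) T) {s} = emeasure ?D {s}"
      using T by (simp add: emeasure_distr emeasure_density nn_integral_indicator_singleton)
  qed auto
  then have "(\<integral>\<^sup>+s. g s \<partial>distr M (count_space UNIV) T) = (\<integral>\<^sup>+s. g s \<partial>?D)" by simp
  then show ?thesis
    using T by (simp add: nn_integral_distr nn_integral_density)
qed

section \<open>The request sequence up to the stopping time\<close>

definition stop_prefix :: "nat \<Rightarrow> nat stream \<Rightarrow> nat list" where
  "stop_prefix n w = stake (stop_time n w) w"

text \<open>These are the values of \<open>stop_prefix\<close> on almost every stream; the clause on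
  \<open>take\<close> says that play has not stopped earlier.\<close>

definition exhausts :: "nat \<Rightarrow> nat list \<Rightarrow> bool" where
  "exhausts n s \<longleftrightarrow> set s = {..<n} \<and> (\<forall>t<length s. \<not> {..<n} \<subseteq> set (take t s))"

lemma measurable_stop_prefix:
  "stop_prefix n \<in> stream_space (measure_pmf q) \<rightarrow>\<^sub>M count_space UNIV"
proof -
  have "stop_time n \<in> stream_space (measure_pmf q) \<rightarrow>\<^sub>M count_space UNIV"
    unfolding stop_time_def[abs_def] by (intro measurable_Least pred_stake_pmf)
  then show ?thesis
    unfolding stop_prefix_def[abs_def] by (rule measurable_compose_countable[OF measurable_stake_pmf])
qed

text \<open>Turns the event of seeing \<open>s\<close> up to the stopping time into a cylinder
  event, whose probability \<open>prob_stake_eq\<close> gives.\<close>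

lemma stop_prefix_eq_iff:
  assumes "exhausts n s"
  shows "stop_prefix n w = s \<longleftrightarrow> stake (length s) w = s"
proof
  assume "stop_prefix n w = s"
  then show "stake (length s) w = s" by (auto simp: stop_prefix_def)
next
  assume s: "stake (length s) w = s"
  have "stop_time n w = length s"
    unfolding stop_time_def
  proof (rule Least_equality)
    show "{..<n} \<subseteq> set (stake (length s) w)" using assms s by (simp add: exhausts_def)
    fix t assume t: "{..<n} \<subseteq> set (stake t w)"
    show "length s \<le> t"
    proof (rule ccontr)
      assume "\<not> length s \<le> t"
      then have "stake t w = take t s" "t < length s"
        using s by (metis min.absorb1 nat_le_linear take_stake, simp)
      with t assms show False by (simp add: exhausts_def)
    qed
  qed
  with s show "stop_prefix n w = s" by (simp add: stop_prefix_def)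
qed

text \<open>Two null sets are discarded: streams with a prefix that leaves the range, handled by
  countability of the set of lists, and streams that miss an item, where \<open>LEAST\<close> has no
  meaning.\<close>

lemma AE_exhausts_stop_prefix:
  assumes q: "set_pmf q = {..<n}"
  shows "AE w in stream_space (measure_pmf q). exhausts n (stop_prefix n w)"
proof -
  let ?M = "stream_space (measure_pmf q)"
  interpret S: prob_space ?M by (rule prob_space_iid_stream)
  have fin: "finite (set_pmf q)" using q by simp
  have "AE w in ?M. stake (length s) w = s \<longrightarrow> set s \<subseteq> {..<n}" for s
  proof (cases "set s \<subseteq> {..<n}")
    case False
    then have "0 \<in> set (map (pmf q) s)" using q by (force simp: set_pmf_eq)
    then have "prod_list (map (pmf q) s) = 0" by (simp add: prod_list_zero_iff)
    then have "measure ?M {w. stake (length s) w = s} = 0" by (simp only: prob_stake_eq[OF fin])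
    then have "emeasure ?M {w \<in> space ?M. stake (length s) w = s} = 0"
      by (simp add: S.emeasure_eq_measure)
    then have "AE w in ?M. stake (length s) w \<noteq> s"
      by (subst AE_iff_measurable[OF _ refl]) (auto intro: pred_stake_pmf[of "\<lambda>u. u = s", unfolded pred_def, simplified])
    then show ?thesis by eventually_elim simp
  qed simp
  then have "AE w in ?M. \<forall>s. stake (length s) w = s \<longrightarrow> set s \<subseteq> {..<n}"
    by (simp add: AE_all_countable)
  moreover have "AE w in ?M. \<exists>t. {..<n} \<subseteq> set (stake t w)"
    using AE_all_requested[OF fin] q by simp
  ultimately show ?thesis
  proof eventually_elim
    case (elim w)
    have len: "length (stop_prefix n w) = stop_time n w" by (simp add: stop_prefix_def)
    have "{..<n} \<subseteq> set (stop_prefix n w)"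
      unfolding stop_prefix_def stop_time_def using elim(2) by (rule LeastI_ex)
    moreover have "set (stop_prefix n w) \<subseteq> {..<n}"
      using elim(1) len by (simp add: stop_prefix_def)
    moreover have "\<not> {..<n} \<subseteq> set (take t (stop_prefix n w))" if "t < stop_time n w" for t
      using not_less_Least[OF that[unfolded stop_time_def]] that
      by (simp add: stop_prefix_def take_stake min_absorb1)
    ultimately show ?case by (auto simp: exhausts_def len)
  qed
qed

text \<open>\<open>butlast s\<close> is a proper prefix, so it still misses an item, and only the
  last letter can supply it.\<close>

lemma exhausts_last:
  assumes "exhausts n s" "n > 0"
  shows "s \<noteq> []" "last s < n" "last s \<notin> set (butlast s)" "{..<n} - {last s} \<subseteq> set (butlast s)"
proof -
  show ne: "s \<noteq> []" using assms by (auto simp: exhausts_def)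
  have split: "set s = insert (last s) (set (butlast s))"
    using ne by (metis append_butlast_last_id list.simps(15) rotate1.simps(2) set_rotate1)
  show "last s < n" "{..<n} - {last s} \<subseteq> set (butlast s)"
    using assms(1) split by (auto simp: exhausts_def)
  have "\<not> {..<n} \<subseteq> set (butlast s)"
    using assms(1) ne by (auto simp: exhausts_def butlast_conv_take)
  then show "last s \<notin> set (butlast s)"
    using assms(1) split by (metis exhausts_def insert_absorb subset_refl)
qed

lemma last_stop_prefix_all_before:
  assumes "exhausts n (stop_prefix n w)" "n > 0" "last (stop_prefix n w) = l"
  shows "w \<in> all_before ({..<n} - {l}) l"
proof -
  have "butlast (stop_prefix n w) = stake (stop_time n w - 1) w"
    by (simp add: stop_prefix_def butlast_conv_take take_stake)
  with exhausts_last[OF assms(1,2)] assms(3) show ?thesis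
    unfolding all_before_def by auto
qed

section \<open>One light item and one expensive slot\<close>

definition light_freq :: "nat \<Rightarrow> real \<Rightarrow> nat \<Rightarrow> real list" where
  "light_freq K \<epsilon> l = (replicate (Suc K) 1)[l := \<epsilon>]"

definition unit_last_costs :: "nat \<Rightarrow> real list" where
  "unit_last_costs K = replicate K 0 @ [1]"

lemma length_light_freq [simp]: "length (light_freq K \<epsilon> l) = Suc K"
  by (simp add: light_freq_def del: replicate_Suc)

lemma nth_light_freq:
  "l \<le> K \<Longrightarrow> i \<le> K \<Longrightarrow> light_freq K \<epsilon> l ! i = (if i = l then \<epsilon> else 1)"
  by (auto simp: light_freq_def nth_list_update simp del: replicate_Suc)

lemma sum_list_light_freq: "l \<le> K \<Longrightarrow> sum_list (light_freq K \<epsilon> l) = K + \<epsilon>"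
proof -
  assume l: "l \<le> K"
  have "sum_list (light_freq K \<epsilon> l) = (\<Sum>i<Suc K. 1 + (if i = l then \<epsilon> - 1 else 0))"
    unfolding sum_list_sum_nth atLeast0LessThan length_light_freq
    using l by (intro sum.cong) (auto simp: nth_light_freq)
  also have "\<dots> = K + \<epsilon>" using l by (simp add: sum.distrib del: sum.lessThan_Suc)
  finally show ?thesis .
qed

lemma length_unit_last_costs [simp]: "length (unit_last_costs K) = Suc K"
  by (simp add: unit_last_costs_def)

lemma nth_unit_last_costs: "i \<le> K \<Longrightarrow> unit_last_costs K ! i = (if i = K then 1 else 0)"
  by (auto simp: unit_last_costs_def nth_append)

lemma sorted_unit_last_costs: "sorted (unit_last_costs K)"
  by (auto simp: unit_last_costs_def sorted_append)

lemma osa_instance_light: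
  assumes "0 < \<epsilon>"
  shows "osa_instance (light_freq K \<epsilon> l) (unit_last_costs K)"
  using assms set_update_subset_insert[of "replicate (Suc K) (1::real)" l \<epsilon>]
    sorted_unit_last_costs[of K]
  by (auto simp: osa_instance_def light_freq_def unit_last_costs_def simp del: replicate_Suc)

lemma num_below_max_unit_last_costs: "num_below_max (unit_last_costs K) = K"
proof -
  have "Max (set (unit_last_costs K)) = 1"
    by (intro Max_eqI) (auto simp: unit_last_costs_def)
  then have "{j. j < length (unit_last_costs K) \<and> unit_last_costs K ! j < Max (set (unit_last_costs K))} = {..<K}"
    by (auto simp: nth_unit_last_costs less_Suc_eq_le split: if_splits)
  then show ?thesis by (simp add: num_below_max_def)
qed

text \<open>Only slot \<open>K\<close> costs anything, so the cost is the frequency of the one item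
  placed there.\<close>

lemma assignment_cost_light:
  assumes "l \<le> K" "bij_betw \<pi> {..K} {..K}"
  shows "assignment_cost (light_freq K \<epsilon> l) (unit_last_costs K) \<pi> = (if \<pi> l = K then \<epsilon> else 1)"
proof -
  obtain j where j: "j \<le> K" "\<pi> j = K"
    using assms(2) by (force simp: bij_betw_def image_iff)
  have iff: "\<pi> i = K \<longleftrightarrow> i = j" if "i \<le> K" for i
    using assms(2) j that by (metis atMost_iff bij_betw_def inj_onD)
  have "\<pi> i \<le> K" if "i \<le> K" for i
    using assms(2) that by (auto simp: bij_betw_def)
  then have "assignment_cost (light_freq K \<epsilon> l) (unit_last_costs K) \<pi> =
      (\<Sum>i\<le>K. if i = j then light_freq K \<epsilon> l ! j else 0)"
    unfolding assignment_cost_def length_light_freq lessThan_Suc_atMost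
    by (intro sum.cong) (auto simp: nth_unit_last_costs iff)
  also have "\<dots> = light_freq K \<epsilon> l ! j" using j by simp
  finally show ?thesis using assms(1) j iff by (auto simp: nth_light_freq)
qed

text \<open>Swapping \<open>l\<close> and \<open>K\<close> puts the light item into the expensive
  slot; \<open>\<epsilon> \<le> 1\<close> makes this the minimum.\<close>

lemma opt_cost_light:
  assumes "l \<le> K" "\<epsilon> \<le> 1"
  shows "opt_cost (light_freq K \<epsilon> l) (unit_last_costs K) = \<epsilon>"
proof -
  have cost: "assignment_cost (light_freq K \<epsilon> l) (unit_last_costs K) \<pi> = (if \<pi> l = K then \<epsilon> else 1)"
    if "\<pi> permutes {..<Suc K}" for \<pi>
    using that assms(1) by (intro assignment_cost_light) (auto simp: lessThan_Suc_atMost permutes_imp_bij)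
  have perm: "Transposition.transpose l K permutes {..<Suc K}"
    using assms by (intro permutes_swap_id) auto
  show ?thesis
    unfolding opt_cost_def length_unit_last_costs
  proof (rule Min_eqI)
    show "finite (assignment_cost (light_freq K \<epsilon> l) (unit_last_costs K) ` {\<pi>. \<pi> permutes {..<Suc K}})"
      by (intro finite_imageI finite_permutations) simp
    show "\<epsilon> \<in> assignment_cost (light_freq K \<epsilon> l) (unit_last_costs K) ` {\<pi>. \<pi> permutes {..<Suc K}}"
      using cost[OF perm] perm by (intro image_eqI[of _ _ "Transposition.transpose l K"]) auto
  qed (use cost assms(2) in auto)
qed

section \<open>The algorithm on a fixed request list\<close>

lemma play_assignment:
  assumes "online_algorithm A" "sorted c" "set rs \<subseteq> {..<length c}" "dom \<sigma> = set rs"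
    "inj_on \<sigma> (dom \<sigma>)" "ran \<sigma> \<subseteq> {..<length c}" "set is \<subseteq> {..<length c}"
    "\<tau> \<in> set_pmf (play A c rs \<sigma> is)"
  shows "dom \<tau> = set rs \<union> set is \<and> inj_on \<tau> (dom \<tau>) \<and> ran \<tau> \<subseteq> {..<length c}"
  using assms(3-)
proof (induction "is" arbitrary: rs \<sigma>)
  case Nil
  then show ?case by simp
next
  case (Cons i "is")
  show ?case
  proof (cases "i \<in> dom \<sigma>")
    case True
    with Cons.prems have "\<tau> \<in> set_pmf (play A c (rs @ [i]) \<sigma> is)" by simp
    then have "dom \<tau> = set (rs @ [i]) \<union> set is \<and> inj_on \<tau> (dom \<tau>) \<and> ran \<tau> \<subseteq> {..<length c}"
      using Cons.prems True by (intro Cons.IH[of "rs @ [i]" \<sigma>]) auto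
    then show ?thesis by auto
  next
    case False
    with Cons.prems obtain j where j: "j \<in> set_pmf (A c rs \<sigma> i)"
      "\<tau> \<in> set_pmf (play A c (rs @ [i]) (\<sigma>(i \<mapsto> j)) is)"
      by auto
    \<comment> \<open>These are the premises of \<open>online_algorithm\<close>; keeping them along
      the play is why the induction generalises over \<open>rs\<close> and
      \<open>\<sigma>\<close>.\<close>
    have "sorted c \<and> set rs \<subseteq> {..<length c} \<and> i < length c \<and> i \<notin> set rs \<and>
        dom \<sigma> = set rs \<and> inj_on \<sigma> (dom \<sigma>) \<and> ran \<sigma> \<subseteq> {..<length c}"
      using Cons.prems False assms(2) by auto
    then have "set_pmf (A c rs \<sigma> i) \<subseteq> {..<length c} - ran \<sigma>"
      using assms(1) unfolding online_algorithm_def by blast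
    with j have jn: "j < length c" "j \<notin> ran \<sigma>" by auto
    have ran: "ran (\<sigma>(i \<mapsto> j)) = insert j (ran \<sigma>)"
      using False by (intro ran_map_upd) auto
    have "Some j \<notin> \<sigma> ` dom \<sigma>"
      using jn(2) by (auto simp: ran_def)
    then have inj: "inj_on (\<sigma>(i \<mapsto> j)) (dom (\<sigma>(i \<mapsto> j)))"
      using Cons.prems(3) False by (auto simp: inj_on_def image_iff) (metis domI)+
    have "dom \<tau> = set (rs @ [i]) \<union> set is \<and> inj_on \<tau> (dom \<tau>) \<and> ran \<tau> \<subseteq> {..<length c}"
    proof (rule Cons.IH)
      show "dom (\<sigma>(i \<mapsto> j)) = set (rs @ [i])" using Cons.prems(2) by simp
    qed (use Cons.prems j(2) jn inj ran in \<open>auto simp del: fun_upd_apply play.simps\<close>)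
    then show ?thesis by auto
  qed
qed

text \<open>With the request list fixed, the frequencies no longer enter: the same function of
  \<open>s\<close> and \<open>l\<close> is evaluated whichever item is light. This is how hidden
  frequencies are exploited.\<close>

definition dear_prob :: "slot_algorithm \<Rightarrow> nat \<Rightarrow> nat list \<Rightarrow> nat \<Rightarrow> real" where
  "dear_prob A K s l =
     measure_pmf.prob (play A (unit_last_costs K) [] Map.empty s) {\<sigma>. \<sigma> l = Some K}"

lemma dear_prob_nonneg [simp]: "0 \<le> dear_prob A K s l"
  by (simp add: dear_prob_def)

lemma play_exhausts:
  assumes "online_algorithm A" "exhausts (Suc K) s"
    "\<sigma> \<in> set_pmf (play A (unit_last_costs K) [] Map.empty s)"
  shows "dom \<sigma> = {..K}" "inj_on \<sigma> {..K}" "ran \<sigma> \<subseteq> {..K}"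
  using play_assignment[OF assms(1) sorted_unit_last_costs, of "[]" K Map.empty s \<sigma>] assms(2,3)
  by (auto simp: exhausts_def lessThan_Suc_atMost)

text \<open>On the support the final map is a bijection of \<open>{..K}\<close>, so the cost is
  \<open>\<epsilon>\<close> if item \<open>l\<close> is in slot \<open>K\<close> and
  \<open>1\<close> otherwise.\<close>

lemma expected_cost_exhausts:
  assumes "online_algorithm A" "exhausts (Suc K) s" "l \<le> K"
  shows "measure_pmf.expectation (play A (unit_last_costs K) [] Map.empty s)
      (\<lambda>\<sigma>. assignment_cost (light_freq K \<epsilon> l) (unit_last_costs K) (the \<circ> \<sigma>))
    = 1 - (1 - \<epsilon>) * dear_prob A K s l" (is "measure_pmf.expectation ?p ?g = _")
proof -
  have cost: "?g \<sigma> = 1 - (1 - \<epsilon>) * indicator {\<sigma>. \<sigma> l = Some K} \<sigma>" if "\<sigma> \<in> set_pmf ?p" for \<sigma>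
  proof -
    note \<sigma> = play_exhausts[OF assms(1,2) that]
    have "inj_on (the \<circ> \<sigma>) {..K}"
    proof (rule inj_onI)
      fix x y assume xy: "x \<in> {..K}" "y \<in> {..K}" "(the \<circ> \<sigma>) x = (the \<circ> \<sigma>) y"
      then obtain a b where "\<sigma> x = Some a" "\<sigma> y = Some b"
        using \<sigma>(1) by blast
      with xy show "x = y" using \<sigma>(2) by (simp add: inj_on_eq_iff[symmetric, of \<sigma> "{..K}"])
    qed
    moreover have "(the \<circ> \<sigma>) ` {..K} \<subseteq> {..K}"
    proof
      fix x assume "x \<in> (the \<circ> \<sigma>) ` {..K}"
      then obtain i where "i \<in> dom \<sigma>" "x = the (\<sigma> i)" using \<sigma>(1) by auto
      then have "x \<in> ran \<sigma>" by (auto intro: ranI)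
      with \<sigma>(3) show "x \<in> {..K}" by blast
    qed
    ultimately have "bij_betw (the \<circ> \<sigma>) {..K} {..K}"
      unfolding bij_betw_def by (metis endo_inj_surj finite_atMost)
    moreover have "l \<in> dom \<sigma>" using \<sigma>(1) assms(3) by simp
    ultimately show ?thesis
      using assignment_cost_light[OF assms(3)] by (auto simp: indicator_def)
  qed
  have "measure_pmf.expectation ?p ?g =
      measure_pmf.expectation ?p (\<lambda>\<sigma>. 1 - (1 - \<epsilon>) * indicator {\<sigma>. \<sigma> l = Some K} \<sigma>)"
    by (intro integral_cong_AE) (auto simp: AE_measure_pmf_iff cost)
  also have "\<dots> = 1 - (1 - \<epsilon>) * dear_prob A K s l"
    by (subst Bochner_Integration.integral_diff)
      (auto simp: dear_prob_def intro!: integrable_mult_right measure_pmf.integrable_const_bound[where B = 1])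
  finally show ?thesis .
qed

lemma sum_dear_prob_le_1:
  assumes "online_algorithm A" "exhausts (Suc K) s"
  shows "(\<Sum>l\<le>K. dear_prob A K s l) \<le> 1"
proof -
  let ?p = "play A (unit_last_costs K) [] Map.empty s"
  \<comment> \<open>Two items can share slot \<open>K\<close> only outside the support, so the
    events are cut down to the support to become disjoint.\<close>
  let ?X = "\<lambda>l. {\<sigma>. \<sigma> l = Some K} \<inter> set_pmf ?p"
  have "disjoint_family_on ?X {..K}"
    using play_exhausts(2)[OF assms] by (fastforce simp: disjoint_family_on_def inj_on_def)
  then have "(\<Sum>l\<le>K. measure_pmf.prob ?p (?X l)) = measure_pmf.prob ?p (\<Union>l\<le>K. ?X l)"
    by (subst measure_pmf.finite_measure_finite_Union) auto
  then show ?thesis by (simp add: dear_prob_def measure_Int_set_pmf)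
qed

section \<open>Comparing the choices of the light item\<close>

abbreviation light_requests :: "nat \<Rightarrow> real \<Rightarrow> nat \<Rightarrow> nat pmf" where
  "light_requests K \<epsilon> l \<equiv> request_pmf (light_freq K \<epsilon> l)"

abbreviation light_streams :: "nat \<Rightarrow> real \<Rightarrow> nat \<Rightarrow> nat stream measure" where
  "light_streams K \<epsilon> l \<equiv> stream_space (measure_pmf (light_requests K \<epsilon> l))"

lemma pmf_light_requests:
  assumes "0 < \<epsilon>" "l \<le> K"
  shows "pmf (light_requests K \<epsilon> l) i =
    (if i \<le> K then (if i = l then \<epsilon> else 1) / (K + \<epsilon>) else 0)"
proof -
  have "light_freq K \<epsilon> l \<noteq> []"
    using length_light_freq[of K \<epsilon> l] by (metis list.size(3) nat.distinct(1))
  moreover have "\<forall>x\<in>set (light_freq K \<epsilon> l). 0 < x"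
    using osa_instance_light[OF assms(1)] by (simp add: osa_instance_def)
  ultimately show ?thesis
    using assms by (auto simp: pmf_request_pmf sum_list_light_freq nth_light_freq less_Suc_eq_le)
qed

lemma set_pmf_light_requests:
  assumes "0 < \<epsilon>" "l \<le> K"
  shows "set_pmf (light_requests K \<epsilon> l) = {..<Suc K}"
  using assms by (auto simp: set_pmf_eq pmf_light_requests split: if_splits)

text \<open>The denominator is the same for every \<open>l\<close>, so only the number of
  occurrences of \<open>l\<close> decides which choice makes \<open>s\<close> most likely.\<close>

lemma prod_pmf_light_requests:
  assumes "0 < \<epsilon>" "l \<le> K" "set s \<subseteq> {..K}"
  shows "prod_list (map (pmf (light_requests K \<epsilon> l)) s) =
    \<epsilon> ^ count_list s l / (K + \<epsilon>) ^ length s"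
  using assms(3) by (induction s) (auto simp: pmf_light_requests assms)

text \<open>The last item occurs once in \<open>s\<close>, every other item at least once, and
  powers of \<open>\<epsilon> \<le> 1\<close> decrease with the exponent.\<close>

lemma prob_stop_prefix_le:
  assumes \<epsilon>: "0 < \<epsilon>" "\<epsilon> \<le> 1" and "l \<le> K" and s: "exhausts (Suc K) s"
  shows "measure (light_streams K \<epsilon> l) {w. stop_prefix (Suc K) w = s}
    \<le> measure (light_streams K \<epsilon> (last s)) {w. stop_prefix (Suc K) w = s}"
proof -
  note last = exhausts_last[OF s zero_less_Suc]
  have set: "set s = {..K}" using s by (simp add: exhausts_def lessThan_Suc_atMost)
  have prob: "measure (light_streams K \<epsilon> j) {w. stop_prefix (Suc K) w = s} =
      \<epsilon> ^ count_list s j / (K + \<epsilon>) ^ length s" if "j \<le> K" for j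
    using that \<epsilon> set
    by (simp add: stop_prefix_eq_iff[OF s] prob_stake_eq set_pmf_light_requests prod_pmf_light_requests)
  have "count_list (butlast s @ [last s]) (last s) = 1"
    using last(3) by (simp add: count_list_0_iff)
  then have "count_list s (last s) = 1" using last(1) by simp
  moreover have "1 \<le> count_list s l"
    using set assms(3) by (metis One_nat_def Suc_leI atMost_iff count_list_0_iff gr0I)
  ultimately have "\<epsilon> ^ count_list s l \<le> \<epsilon> ^ count_list s (last s)"
    using \<epsilon> by (intro power_decreasing) auto
  then show ?thesis
    using prob assms(3) last(2) \<epsilon> by (simp add: divide_right_mono less_Suc_eq_le)
qed

lemma prob_stop_prefix_eq_0:
  assumes "0 < \<epsilon>" "l \<le> K" "\<not> exhausts (Suc K) s"
  shows "measure (light_streams K \<epsilon> l) {w. stop_prefix (Suc K) w = s} = 0"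
proof -
  let ?M = "light_streams K \<epsilon> l"
  have "AE w in ?M. \<not> stop_prefix (Suc K) w = s"
    using AE_exhausts_stop_prefix[OF set_pmf_light_requests[OF assms(1,2)]]
    by eventually_elim (use assms(3) in auto)
  moreover have "{w \<in> space ?M. stop_prefix (Suc K) w = s} \<in> sets ?M"
    using measurable_stop_prefix by measurable
  ultimately have "emeasure ?M {w. stop_prefix (Suc K) w = s} = 0"
    by (subst (asm) AE_iff_measurable[OF _ refl]) auto
  then show ?thesis by (simp add: measure_def)
qed

text \<open>A Bayesian argument with uniform prior, whose factor \<open>1 / (K + 1)\<close> is
  dropped on both sides. For fixed \<open>s\<close> the weights \<open>dear_prob\<close> add up to
  at most \<open>1\<close>, so the weighted sum of likelihoods is at most the largest one, that of
  \<open>last s\<close>.\<close>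

lemma sum_expected_dear_prob:
  assumes \<epsilon>: "0 < \<epsilon>" "\<epsilon> \<le> 1" and A: "online_algorithm A"
  shows "(\<Sum>l\<le>K. \<integral>\<^sup>+w. dear_prob A K (stop_prefix (Suc K) w) l \<partial>light_streams K \<epsilon> l)
    \<le> (\<Sum>l\<le>K. emeasure (light_streams K \<epsilon> l) (all_before ({..<Suc K} - {l}) l))"
proof -
  let ?M = "light_streams K \<epsilon>" and ?T = "stop_prefix (Suc K)"
  let ?P = "\<lambda>l s. measure (?M l) {w. ?T w = s}"
  \<comment> \<open>\<open>?g\<close> plays the part of \<open>dear_prob\<close> for the rule that
    takes the last item to be the light one.\<close>
  let ?g = "\<lambda>l s. indicator {s. exhausts (Suc K) s \<and> last s = l} s :: real"
  have em: "emeasure (?M l) {w \<in> space (?M l). ?T w = s} = ennreal (?P l s)" for l s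
    using prob_space_iid_stream[of "light_requests K \<epsilon> l"]
    by (simp add: finite_measure.emeasure_eq_measure prob_space.finite_measure)
  have discrete: "(\<integral>\<^sup>+w. ennreal (h (?T w)) \<partial>?M l) = (\<integral>\<^sup>+s. ennreal (?P l s * h s) \<partial>count_space UNIV)"
    if "\<And>s. 0 \<le> h s" for l h
    using nn_integral_discrete[OF measurable_stop_prefix, where g = "\<lambda>s. ennreal (h s)"] that
    by (simp only: em) (simp add: ennreal_mult)
  have ptw: "(\<Sum>l\<le>K. ?P l s * dear_prob A K s l) \<le> (\<Sum>l\<le>K. ?P l s * ?g l s)" for s
  proof (cases "exhausts (Suc K) s")
    case True
    have "(\<Sum>l\<le>K. ?P l s * dear_prob A K s l) \<le> (\<Sum>l\<le>K. ?P (last s) s * dear_prob A K s l)"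
      using prob_stop_prefix_le[OF \<epsilon> _ True]
      by (intro sum_mono mult_right_mono) auto
    also have "\<dots> \<le> ?P (last s) s"
      using mult_left_mono[OF sum_dear_prob_le_1[OF A True], of "?P (last s) s"]
      by (simp add: sum_distrib_left)
    also have "\<dots> = (\<Sum>l\<le>K. if l = last s then ?P l s else 0)"
      using exhausts_last(2)[OF True] by simp
    also have "\<dots> = (\<Sum>l\<le>K. ?P l s * ?g l s)"
      using True by (intro sum.cong) (auto simp: indicator_def)
    finally show ?thesis .
  next
    case False
    then show ?thesis using \<epsilon> by (simp add: prob_stop_prefix_eq_0)
  qed
  have "(\<Sum>l\<le>K. \<integral>\<^sup>+w. dear_prob A K (?T w) l \<partial>?M l) =
      (\<integral>\<^sup>+s. (\<Sum>l\<le>K. ennreal (?P l s * dear_prob A K s l)) \<partial>count_space UNIV)"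
    by (subst nn_integral_sum) (simp, intro sum.cong refl discrete dear_prob_nonneg)
  also have "\<dots> \<le> (\<integral>\<^sup>+s. (\<Sum>l\<le>K. ennreal (?P l s * ?g l s)) \<partial>count_space UNIV)"
  proof (intro nn_integral_mono)
    fix s
    show "(\<Sum>l\<le>K. ennreal (?P l s * dear_prob A K s l)) \<le> (\<Sum>l\<le>K. ennreal (?P l s * ?g l s))"
      using ptw[of s] by (subst (1 2) sum_ennreal) (auto intro: ennreal_leI)
  qed
  also have "\<dots> = (\<Sum>l\<le>K. \<integral>\<^sup>+w. ennreal (?g l (?T w)) \<partial>?M l)"
    by (subst nn_integral_sum) (simp, intro sum.cong refl discrete[symmetric], simp)
  also have "\<dots> \<le> (\<Sum>l\<le>K. \<integral>\<^sup>+w. indicator (all_before ({..<Suc K} - {l}) l) w \<partial>?M l)"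
    using last_stop_prefix_all_before
    by (intro sum_mono nn_integral_mono) (auto simp: indicator_def)
  also have "\<dots> = (\<Sum>l\<le>K. emeasure (?M l) (all_before ({..<Suc K} - {l}) l))"
    by (simp add: all_before_sets)
  finally show ?thesis .
qed

text \<open>The first equation integrates \<open>expected_cost_exhausts\<close> over almost all
  streams. The second links the Bochner integral of the cost to the nonnegative integral in which
  the averaging is done.\<close>

lemma algorithm_cost_light:
  assumes \<epsilon>: "0 < \<epsilon>" and A: "online_algorithm A" and l: "l \<le> K"
  shows "algorithm_cost A (light_freq K \<epsilon> l) (unit_last_costs K) =
    1 - (1 - \<epsilon>) * (\<integral>w. dear_prob A K (stop_prefix (Suc K) w) l \<partial>light_streams K \<epsilon> l)"
    and "(\<integral>\<^sup>+w. dear_prob A K (stop_prefix (Suc K) w) l \<partial>light_streams K \<epsilon> l) =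
    ennreal (\<integral>w. dear_prob A K (stop_prefix (Suc K) w) l \<partial>light_streams K \<epsilon> l)"
proof -
  let ?M = "light_streams K \<epsilon> l" and ?T = "stop_prefix (Suc K)"
  interpret S: prob_space ?M by (rule prob_space_iid_stream)
  have meas: "(\<lambda>w. h (?T w)) \<in> borel_measurable ?M" for h :: "nat list \<Rightarrow> real"
    by (rule measurable_compose[OF measurable_stop_prefix]) simp
  have int: "integrable ?M (\<lambda>w. dear_prob A K (?T w) l)"
    using meas[of "\<lambda>s. dear_prob A K s l"]
    by (intro S.integrable_const_bound[of _ 1]) (auto simp: dear_prob_def)
  then show "(\<integral>\<^sup>+w. dear_prob A K (?T w) l \<partial>?M) = ennreal (\<integral>w. dear_prob A K (?T w) l \<partial>?M)"
    by (intro nn_integral_eq_integral) auto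
  let ?h = "\<lambda>s. measure_pmf.expectation (play A (unit_last_costs K) [] Map.empty s)
      (\<lambda>\<sigma>. assignment_cost (light_freq K \<epsilon> l) (unit_last_costs K) (the \<circ> \<sigma>))"
  have "algorithm_cost A (light_freq K \<epsilon> l) (unit_last_costs K) = (\<integral>w. ?h (?T w) \<partial>?M)"
    by (simp add: algorithm_cost_def final_assignment_def stop_prefix_def)
  also have "\<dots> = (\<integral>w. 1 - (1 - \<epsilon>) * dear_prob A K (?T w) l \<partial>?M)"
  proof (rule integral_cong_AE)
    show "AE w in ?M. ?h (?T w) = 1 - (1 - \<epsilon>) * dear_prob A K (?T w) l"
      using AE_exhausts_stop_prefix[OF set_pmf_light_requests[OF \<epsilon> l]]
      by eventually_elim (rule expected_cost_exhausts[OF A _ l])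
  qed (use meas[of ?h] meas[of "\<lambda>s. 1 - (1 - \<epsilon>) * dear_prob A K s l"] in auto)
  also have "\<dots> = 1 - (1 - \<epsilon>) * (\<integral>w. dear_prob A K (?T w) l \<partial>?M)"
    using int S.prob_space by simp
  finally show "algorithm_cost A (light_freq K \<epsilon> l) (unit_last_costs K) =
    1 - (1 - \<epsilon>) * (\<integral>w. dear_prob A K (?T w) l \<partial>?M)" .
qed

lemma prob_light_last_le:
  assumes \<epsilon>: "0 < \<epsilon>" and l: "l \<le> K"
  shows "measure (light_streams K \<epsilon> l) (all_before ({..<Suc K} - {l}) l) \<le> 1 / (1 + \<epsilon> * harm K)"
proof -
  have "measure (light_streams K \<epsilon> l) (all_before ({..<Suc K} - {l}) l)
      * (1 + \<epsilon> * harm (card ({..<Suc K} - {l}))) \<le> 1"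
    using \<epsilon> l
    \<comment> \<open>\<open>h\<close> is the request probability of a heavy item, and
      \<open>R\<close> consists of all \<open>K\<close> heavy items.\<close>
    by (intro prob_all_before[where h = "1 / (K + \<epsilon>)"])
      (auto simp: set_pmf_light_requests pmf_light_requests less_Suc_eq_le)
  moreover have "card ({..<Suc K} - {l}) = K" using l by simp
  moreover have "0 < 1 + \<epsilon> * harm K" using \<epsilon> harm_nonneg[where 'a = real, of K] by (simp add: add_pos_nonneg)
  ultimately show ?thesis by (simp add: pos_le_divide_eq)
qed

text \<open>The \<open>K + 1\<close> values \<open>?I l\<close> sum to at most
  \<open>(K + 1) * ?p\<close>, so one of them is at most \<open>?p\<close>. The item found may
  depend on \<open>A\<close> and \<open>\<epsilon>\<close>.\<close>

lemma exists_bad_light_item: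
  assumes \<epsilon>: "0 < \<epsilon>" "\<epsilon> \<le> 1" and A: "online_algorithm A"
  shows "\<exists>l\<le>K. (1 + harm K) / (1 + \<epsilon> * harm K)
    \<le> algorithm_cost A (light_freq K \<epsilon> l) (unit_last_costs K)
      / opt_cost (light_freq K \<epsilon> l) (unit_last_costs K)"
proof -
  let ?M = "light_streams K \<epsilon>"
  let ?I = "\<lambda>l. \<integral>w. dear_prob A K (stop_prefix (Suc K) w) l \<partial>?M l"
  let ?B = "\<lambda>l. measure (?M l) (all_before ({..<Suc K} - {l}) l)"
  let ?p = "1 / (1 + \<epsilon> * harm K)"
  have pos: "0 < 1 + \<epsilon> * harm K" using \<epsilon> harm_nonneg[where 'a = real, of K] by (simp add: add_pos_nonneg)
  have em: "emeasure (?M l) X = ennreal (measure (?M l) X)" for l X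
    using prob_space_iid_stream[of "light_requests K \<epsilon> l"]
    by (simp add: finite_measure.emeasure_eq_measure prob_space.finite_measure)
  have nonneg: "0 \<le> ?I l" for l
    by simp
  have "ennreal (\<Sum>l\<le>K. ?I l) = (\<Sum>l\<le>K. ennreal (?I l))"
    using nonneg by (simp add: sum_ennreal)
  also have "\<dots> = (\<Sum>l\<le>K. \<integral>\<^sup>+w. dear_prob A K (stop_prefix (Suc K) w) l \<partial>?M l)"
    using algorithm_cost_light(2)[OF \<epsilon>(1) A] by (intro sum.cong) auto
  also have "\<dots> \<le> (\<Sum>l\<le>K. emeasure (?M l) (all_before ({..<Suc K} - {l}) l))"
    by (rule sum_expected_dear_prob[OF \<epsilon> A])
  also have "\<dots> = ennreal (\<Sum>l\<le>K. ?B l)"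
    by (simp add: em sum_ennreal)
  finally have "(\<Sum>l\<le>K. ?I l) \<le> (\<Sum>l\<le>K. ?B l)"
    by (simp add: sum_nonneg ennreal_le_iff)
  also have "\<dots> \<le> (\<Sum>l\<le>K. ?p)"
    using prob_light_last_le[OF \<epsilon>(1)] by (intro sum_mono) auto
  finally have sum_le: "(\<Sum>l\<le>K. ?I l) \<le> (\<Sum>l\<le>K. ?p)" .
  have "\<exists>l\<le>K. ?I l \<le> ?p"
  proof (rule ccontr)
    assume "\<not> (\<exists>l\<le>K. ?I l \<le> ?p)"
    then have "?p < ?I l" if "l \<in> {..K}" for l
      using that by (meson atMost_iff not_le)
    then have "(\<Sum>l\<le>K. ?p) < (\<Sum>l\<le>K. ?I l)"
      by (intro sum_strict_mono) auto
    with sum_le show False by linarith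
  qed
  then obtain l where l: "l \<le> K" "?I l \<le> ?p" by blast
  \<comment> \<open>Here \<open>1 - ?p = \<epsilon> * harm K * ?p\<close>, and adding
    \<open>\<epsilon> * ?p\<close> produces the factor \<open>1 + harm K\<close>.\<close>
  have "1 - (1 - \<epsilon>) * ?p = \<epsilon> * ((1 + harm K) / (1 + \<epsilon> * harm K))"
    using pos by (simp add: field_simps)
  then have "(1 + harm K) / (1 + \<epsilon> * harm K) = (1 - (1 - \<epsilon>) * ?p) / \<epsilon>"
    using \<epsilon>(1) by simp
  also have "\<dots> \<le> (1 - (1 - \<epsilon>) * ?I l) / \<epsilon>"
    using l(2) \<epsilon> by (intro divide_right_mono diff_left_mono mult_left_mono) auto
  also have "\<dots> = algorithm_cost A (light_freq K \<epsilon> l) (unit_last_costs K)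
      / opt_cost (light_freq K \<epsilon> l) (unit_last_costs K)"
    by (simp only: algorithm_cost_light(1)[OF \<epsilon>(1) A l(1)] opt_cost_light[OF l(1) \<epsilon>(2)])
  finally show ?thesis using l(1) by blast
qed

text \<open>The class is kept abstract to serve both claims. The bad item varies with
  \<open>\<epsilon>\<close>, but the supremum absorbs this, so only the numerical bound has to
  converge.\<close>

lemma competitive_ratio_ge_harm:
  assumes A: "online_algorithm A"
    and I: "\<And>\<epsilon> l. 0 < \<epsilon> \<Longrightarrow> l \<le> K \<Longrightarrow> (light_freq K \<epsilon> l, unit_last_costs K) \<in> \<I>"
  shows "ereal (1 + harm K) \<le> competitive_ratio A \<I>"
proof -
  have le: "ereal ((1 + harm K) / (1 + \<epsilon> * harm K)) \<le> competitive_ratio A \<I>"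
    if "0 < \<epsilon>" "\<epsilon> \<le> 1" for \<epsilon>
  proof -
    obtain l where l: "l \<le> K" "(1 + harm K) / (1 + \<epsilon> * harm K)
        \<le> algorithm_cost A (light_freq K \<epsilon> l) (unit_last_costs K)
          / opt_cost (light_freq K \<epsilon> l) (unit_last_costs K)"
      using exists_bad_light_item[OF \<open>0 < \<epsilon>\<close> \<open>\<epsilon> \<le> 1\<close> A] by blast
    show ?thesis
      unfolding competitive_ratio_def
      by (rule SUP_upper2[OF I[OF that(1) l(1)]]) (use l(2) in simp)
  qed
  have "((\<lambda>\<epsilon>::real. (1 + harm K) / (1 + \<epsilon> * harm K)) \<longlongrightarrow> (1 + harm K) / (1 + 0 * harm K)) (at_right 0)"
    by (intro tendsto_intros) auto
  then have "((\<lambda>\<epsilon>::real. ereal ((1 + harm K) / (1 + \<epsilon> * harm K))) \<longlongrightarrow> ereal (1 + harm K)) (at_right 0)"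
    by simp
  moreover have "\<forall>\<^sub>F \<epsilon>::real in at_right 0. \<epsilon> < 1 \<and> 0 < \<epsilon>"
    by (intro eventually_conj eventually_at_right_less eventually_at_rightI[of 0 1]) auto
  then have "\<forall>\<^sub>F \<epsilon>::real in at_right 0. ereal ((1 + harm K) / (1 + \<epsilon> * harm K)) \<le> competitive_ratio A \<I>"
    by eventually_elim (rule le, auto)
  ultimately show ?thesis
    by (rule tendsto_upperbound) simp
qed

theorem theorem3:
  shows "(\<forall>K::nat. K \<ge> 1 \<longrightarrow> (\<forall>A. online_algorithm A \<longrightarrow>
            competitive_ratio A
              {(f, c). osa_instance f c \<and> set c \<subseteq> {0, 1} \<and> num_below_max c \<le> K}
            \<ge> ereal (1 + harm K))) \<and>
         (\<forall>A. online_algorithm A \<longrightarrow>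
            competitive_ratio A
              {(f, c). osa_instance f c \<and> set c \<subseteq> {0, 1} \<and> concave_costs c}
            \<ge> 2)"
proof (intro conjI allI impI)
  fix K :: nat and A assume "online_algorithm A"
  then show "ereal (1 + harm K) \<le> competitive_ratio A
      {(f, c). osa_instance f c \<and> set c \<subseteq> {0, 1} \<and> num_below_max c \<le> K}"
    by (rule competitive_ratio_ge_harm)
      (auto simp: osa_instance_light num_below_max_unit_last_costs, auto simp: unit_last_costs_def)
next
  fix A assume "online_algorithm A"
  \<comment> \<open>A single free slot suffices, since \<open>1 + harm 1 = 2\<close>.\<close>
  then have "ereal (1 + harm 1) \<le> competitive_ratio A
      {(f, c). osa_instance f c \<and> set c \<subseteq> {0, 1} \<and> concave_costs c}"
    by (rule competitive_ratio_ge_harm)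
      (auto simp: osa_instance_light concave_costs_def, auto simp: unit_last_costs_def)
  then show "2 \<le> competitive_ratio A
      {(f, c). osa_instance f c \<and> set c \<subseteq> {0, 1} \<and> concave_costs c}"
    by (simp add: harm_def)
qed

end
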